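(* For every integer $c\in[6,36]\setminus\{7,29\}$, there exists a quantum Latin square of order $6$ with cardinality $c$. Moreover, no quantum Latin square of order $6$ has cardinality $7$.
   Context: A quantum Latin square of order $n$, denoted $\mathrm{QLS}(n)$, is an $n\times n$ array $(\phi_{ij})_{0\le i,j\le n-1}$ of unit vectors in $\mathbb{C}^n$ such that every row and every column forms an orthonormal basis of $\mathbb{C}^n$. Two unit vectors $u,v$ are phase equivalent, $u\sim v$, if $u=e^{i\alpha}v$ for some $\alpha\in\mathbb{R}$. The cardinality of a quantum Latin square is the number of distinct phase-equivalence classes among its $n^2$ entries. *)

theory Defs
  imports
    Complex_Main
    "Jordan_Normal_Form.Conjugate"
    "Jordan_Normal_Form.VS_Connect"
begin

definition orthonormal_basis :: "nat \<Rightarrow> (nat \<Rightarrow> complex vec) \<Rightarrow> bool" where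
  "orthonormal_basis n f \<longleftrightarrow>
     (\<forall>i<n. \<forall>j<n. f i \<bullet>c f j = (if i = j then 1 else 0)) \<and>
     vectorspace.basis class_ring (module_vec TYPE(complex) n) (f ` {..<n})"

definition unit_vectors :: "nat \<Rightarrow> complex vec set" where
  "unit_vectors n = {v \<in> carrier_vec n. v \<bullet>c v = 1}"

(* Arrays are indexed from 0; entries outside the n x n range are irrelevant. *)
definition quantum_latin_square :: "nat \<Rightarrow> (nat \<Rightarrow> nat \<Rightarrow> complex vec) \<Rightarrow> bool" where
  "quantum_latin_square n \<phi> \<longleftrightarrow>
     (\<forall>i<n. \<forall>j<n. \<phi> i j \<in> unit_vectors n) \<and>
     (\<forall>i<n. orthonormal_basis n (\<lambda>j. \<phi> i j)) \<and>
     (\<forall>j<n. orthonormal_basis n (\<lambda>i. \<phi> i j))"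

definition phase_equiv :: "nat \<Rightarrow> (complex vec \<times> complex vec) set" where
  "phase_equiv n =
     {(u, v). u \<in> unit_vectors n \<and> v \<in> unit_vectors n \<and>
              (\<exists>\<alpha>::real. u = exp (\<i> * of_real \<alpha>) \<cdot>\<^sub>v v)}"

definition qls_cardinality :: "nat \<Rightarrow> (nat \<Rightarrow> nat \<Rightarrow> complex vec) \<Rightarrow> nat" where
  "qls_cardinality n \<phi> = card ({\<phi> i j | i j. i < n \<and> j < n} // phase_equiv n)"

end

theory Submission
  imports Defs "Jordan_Normal_Form.Determinant"
begin

text \<open>
  Cardinality \<open>n + 1\<close> is impossible for every order \<open>n\<close>: with only \<open>n + 1\<close> classes available, any
  two rows share at least \<open>n - 1\<close> of them, and an orthonormal basis of \<open>\<complex>\<^sup>n\<close> is determined up to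
  phase by \<open>n - 1\<close> of its vectors, so all rows consist of the same \<open>n\<close> classes.

  For existence, vectors need not be normalized, so it suffices to give a \<open>6 \<times> 6\<close> array of Gaussian
  integer vectors whose rows and columns are orthogonal; the orthogonality and the number of
  distinct lines are then decided by computation.
\<close>

section \<open>Orthonormal bases\<close>

text \<open>Orthogonality and the line spanned by a vector do not change under nonzero rescaling,
  and two unit vectors are phase equivalent exactly when they span the same line. Both halves
  therefore work with lines: the square roots of normalization and the angles of phases never enter
  a computation. Cardinalities above 6 arise by replacing basis vectors with other orthogonal bases
  of the subspaces they span. Rotating a pair of basis vectors brings in two lines at once; odd
  totals can arise when a standard basis line disappears altogether, as in the square of cardinality
  9. The value 29 is neither realized nor excluded here.\<close>

lemma cscalar_smult_left:
  fixes u v :: "complex vec"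
  assumes "u \<in> carrier_vec n" "v \<in> carrier_vec n"
  shows "(a \<cdot>\<^sub>v u) \<bullet>c v = a * (u \<bullet>c v)"
  using assms by simp

lemma cscalar_commute_zero:
  fixes u v :: "complex vec"
  assumes "u \<in> carrier_vec n" "v \<in> carrier_vec n" "u \<bullet>c v = 0"
  shows "v \<bullet>c u = 0"
  by (metis assms conjugate_complex_def complex_cnj_zero conjugate_conjugate_sprod conjugate_vec_sprod_comm)

lemma cscalar_diff_left:
  fixes u v w :: "complex vec"
  assumes "u \<in> carrier_vec n" "v \<in> carrier_vec n" "w \<in> carrier_vec n"
  shows "(u - v) \<bullet>c w = u \<bullet>c w - v \<bullet>c w"
  using assms by (intro minus_scalar_prod_distrib) auto

context
  fixes n :: nat and f :: "nat \<Rightarrow> complex vec"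
  assumes carrier: "\<And>i. i < n \<Longrightarrow> f i \<in> carrier_vec n"
    and orthonormal: "\<And>i j. i < n \<Longrightarrow> j < n \<Longrightarrow> f i \<bullet>c f j = (if i = j then 1 else 0)"
begin

text \<open>Orthonormality of the rows of \<open>A\<close> says that \<open>A\<close> times its
  conjugate transpose \<open>B\<close> is the identity. For square matrices \<open>B * A\<close> is
  then the identity too, and this reversed product expresses completeness of the system.\<close>

private definition A where "A = mat n n (\<lambda>(i, k). f i $ k)"
private definition B where "B = mat n n (\<lambda>(k, j). cnj (f j $ k))"

private lemma A: "A \<in> carrier_mat n n" and B: "B \<in> carrier_mat n n"
  by (auto simp: A_def B_def)

private lemma AB: "A * B = 1\<^sub>m n"
proof (rule eq_matI)
  fix i j assume "i < dim_row (1\<^sub>m n :: complex mat)" "j < dim_col (1\<^sub>m n :: complex mat)"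
  then have ij: "i < n" "j < n" by auto
  have "row A i = f i" "col B j = conjugate (f j)"
    using carrier[OF ij(1)] carrier[OF ij(2)] ij by (auto simp: A_def B_def)
  then show "(A * B) $$ (i, j) = 1\<^sub>m n $$ (i, j)"
    using orthonormal[OF ij] ij A B by auto
qed (auto simp: A_def B_def)

text \<open>Discharges the basis clause of \<open>orthonormal_basis\<close>, so that only inner
  products remain to be checked: \<open>A * B = 1\<close> makes \<open>det A\<close> nonzero, and n
  independent vectors in dimension n form a basis.\<close>

lemma orthonormal_imp_basis:
  "vectorspace.basis class_ring (module_vec TYPE(complex) n) (f ` {..<n})"
proof -
  interpret vec_space "TYPE(complex)" n .
  have "det A * det B = 1"
    using det_mult[OF A B] AB by simp
  then have "det A \<noteq> 0" by auto
  then have indpt: "lin_indpt (set (rows A))"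
    by (rule det_not_0_imp_lin_indpt_rows[OF A])
  have "row A i = f i" if "i < n" for i
    using carrier[OF that] that by (auto simp: A_def)
  then have rows: "set (rows A) = f ` {..<n}"
    using A by (auto simp: rows_def)
  have "inj_on f {..<n}"
  proof (rule inj_onI)
    fix i j assume "i \<in> {..<n}" "j \<in> {..<n}" "f i = f j"
    then show "i = j" using orthonormal[of i j] orthonormal[of i i] by (auto split: if_splits)
  qed
  then have "card (f ` {..<n}) = dim"
    by (simp add: card_image dim_is_n)
  then show ?thesis
    using indpt carrier unfolding rows
    by (intro dim_li_is_basis) (simp_all add: image_subset_iff)
qed

lemma orthogonal_to_orthonormal_imp_zero:
  assumes v: "v \<in> carrier_vec n" and orth: "\<And>j. j < n \<Longrightarrow> v \<bullet>c f j = 0"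
  shows "v = 0\<^sub>v n"
proof -
  have BA: "B * A = 1\<^sub>m n"
    by (rule mat_mult_left_right_inverse[OF A B AB])
  have "col B j = conjugate (f j)" if "j < n" for j
    using carrier[OF that] that by (auto simp: B_def)
  \<comment> \<open>Row j of \<open>transpose_mat B\<close> is the conjugate of \<open>f j\<close>,
    so this product lists the inner products of v with the \<open>f j\<close>. Applying
    \<open>transpose_mat A\<close> then recovers v.\<close>
  then have "transpose_mat B *\<^sub>v v = 0\<^sub>v n"
    using orth v carrier B by (intro eq_vecI) (simp_all add: comm_scalar_prod[of "conjugate (f _)" n v])
  then have "transpose_mat A *\<^sub>v (transpose_mat B *\<^sub>v v) = 0\<^sub>v n"
    using A by auto
  moreover have "transpose_mat A * transpose_mat B = 1\<^sub>m n"
    using transpose_mult[OF B A] BA by simp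
  ultimately show ?thesis
    using A B v assoc_mult_mat_vec[of "transpose_mat A" n n "transpose_mat B" n v] by simp
qed

text \<open>Subtracting from v its projection onto \<open>f k\<close> leaves a vector orthogonal to
  every \<open>f j\<close>, including \<open>f k\<close>, hence zero.\<close>

lemma orthonormal_all_but_one:
  assumes v: "v \<in> carrier_vec n" and k: "k < n"
    and orth: "\<And>j. j < n \<Longrightarrow> j \<noteq> k \<Longrightarrow> v \<bullet>c f j = 0"
  shows "v = (v \<bullet>c f k) \<cdot>\<^sub>v f k"
proof -
  let ?p = "(v \<bullet>c f k) \<cdot>\<^sub>v f k"
  have p: "?p \<in> carrier_vec n" using carrier[OF k] by simp
  have "v - ?p = 0\<^sub>v n"
  proof (rule orthogonal_to_orthonormal_imp_zero)
    fix j assume j: "j < n"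
    show "(v - ?p) \<bullet>c f j = 0"
      using orth[OF j] orthonormal[OF k j] carrier[OF j] carrier[OF k]
      by (cases "j = k") (auto simp: cscalar_diff_left[OF v p] cscalar_smult_left)
  qed (use v p in simp)
  then have "(v - ?p) $ i = 0" if "i < n" for i
    using that by simp
  then show ?thesis
    using v p carrier[OF k] by (intro eq_vecI) auto
qed

end

section \<open>Phase equivalence\<close>

lemma equiv_phase_equiv: "equiv (unit_vectors n) (phase_equiv n)"
proof (rule equivI)
  show "phase_equiv n \<subseteq> unit_vectors n \<times> unit_vectors n"
    by (auto simp: phase_equiv_def)
  show "refl_on (unit_vectors n) (phase_equiv n)"
    by (auto simp: refl_on_def phase_equiv_def intro!: exI[of _ "0::real"])
  show "sym (phase_equiv n)"
  proof (rule symI)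
    fix u v assume "(u, v) \<in> phase_equiv n"
    then obtain a :: real where u: "u = exp (\<i> * of_real a) \<cdot>\<^sub>v v"
      and uv: "u \<in> unit_vectors n" "v \<in> unit_vectors n"
      by (auto simp: phase_equiv_def)
    have "v = exp (\<i> * of_real (- a)) \<cdot>\<^sub>v u"
      unfolding u by (simp add: smult_smult_assoc flip: exp_add)
    then show "(v, u) \<in> phase_equiv n"
      using uv unfolding phase_equiv_def by blast
  qed
  show "trans (phase_equiv n)"
  proof (rule transI)
    fix u v w assume "(u, v) \<in> phase_equiv n" "(v, w) \<in> phase_equiv n"
    then obtain a b :: real where "u = exp (\<i> * of_real a) \<cdot>\<^sub>v v" "v = exp (\<i> * of_real b) \<cdot>\<^sub>v w"
      and uw: "u \<in> unit_vectors n" "w \<in> unit_vectors n"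
      by (auto simp: phase_equiv_def)
    then have "u = exp (\<i> * of_real (a + b)) \<cdot>\<^sub>v w"
      by (simp add: smult_smult_assoc algebra_simps flip: exp_add)
    then show "(u, w) \<in> phase_equiv n"
      using uw unfolding phase_equiv_def by blast
  qed
qed

text \<open>Forgets that the scalar has modulus 1; being nonzero is all that orthogonality and
  comparison of lines require.\<close>

lemma phase_equivE:
  assumes "(u, v) \<in> phase_equiv n"
  obtains t where "t \<noteq> 0" "u = t \<cdot>\<^sub>v v" "u \<in> carrier_vec n" "v \<in> carrier_vec n"
proof -
  obtain a :: real where "u = exp (\<i> * of_real a) \<cdot>\<^sub>v v"
    using assms by (auto simp: phase_equiv_def)
  then show thesis
    using assms by (intro that[of "exp (\<i> * of_real a)"]) (auto simp: phase_equiv_def unit_vectors_def)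
qed

text \<open>Two unit vectors on the same line can differ only by a scalar of modulus 1, and
  \<open>Arg t\<close> supplies the angle.\<close>

lemma phase_equivI:
  assumes u: "u \<in> unit_vectors n" and v: "v \<in> unit_vectors n" and t: "u = t \<cdot>\<^sub>v v"
  shows "(u, v) \<in> phase_equiv n"
proof -
  have "t * cnj t = 1"
    using u v unfolding t unit_vectors_def
    by (auto simp: conjugate_smult_vec mult.commute)
  then have "(cmod t)\<^sup>2 = 1"
    unfolding complex_norm_square[symmetric] by (metis of_real_eq_1_iff)
  then have "cmod t = 1"
    using norm_ge_zero[of t] unfolding power2_eq_1_iff by linarith
  then have "exp (\<i> * of_real (Arg t)) = t"
    using rcis_cmod_Arg[of t] by (simp add: rcis_def cis_conv_exp)
  then have "u = exp (\<i> * of_real (Arg t)) \<cdot>\<^sub>v v"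
    using t by simp
  then show ?thesis
    using u v unfolding phase_equiv_def by blast
qed

lemma orthogonal_cong_phase:
  assumes "(u, u') \<in> phase_equiv n" "(v, v') \<in> phase_equiv n"
  shows "u \<bullet>c v = 0 \<longleftrightarrow> u' \<bullet>c v' = 0"
proof -
  obtain s t where "s \<noteq> 0" "t \<noteq> 0" "u = s \<cdot>\<^sub>v u'" "v = t \<cdot>\<^sub>v v'"
    "u' \<in> carrier_vec n" "v' \<in> carrier_vec n"
    using assms by (meson phase_equivE)
  then show ?thesis
    by (simp add: conjugate_smult_vec)
qed

section \<open>Two rows cannot differ in exactly one phase class\<close>

text \<open>If two rows share all but one of their classes, then each remaining vector is orthogonal to
  the span of the common ones, a hyperplane, so the two remaining classes agree as well.\<close>

lemma orthonormal_classes_eq: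
  assumes f: "\<And>i. i < n \<Longrightarrow> f i \<in> unit_vectors n" "orthonormal_basis n f"
    and g: "\<And>i. i < n \<Longrightarrow> g i \<in> unit_vectors n" "orthonormal_basis n g"
  defines "F \<equiv> (\<lambda>i. phase_equiv n `` {f i}) ` {..<n}"
    and "G \<equiv> (\<lambda>i. phase_equiv n `` {g i}) ` {..<n}"
  assumes card: "card (F \<union> G) \<le> Suc n"
  shows "F = G"
proof -
  let ?c = "\<lambda>u. phase_equiv n `` {u}"
  have orth_f: "f i \<bullet>c f j = (if i = j then 1 else 0)" if "i < n" "j < n" for i j
    using f(2) that by (auto simp: orthonormal_basis_def)
  have orth_g: "g i \<bullet>c g j = (if i = j then 1 else 0)" if "i < n" "j < n" for i j
    using g(2) that by (auto simp: orthonormal_basis_def)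
  have eq_class: "?c u = ?c v \<longleftrightarrow> (u, v) \<in> phase_equiv n"
    if "u \<in> unit_vectors n" "v \<in> unit_vectors n" for u v
    using eq_equiv_class_iff[OF equiv_phase_equiv that] .
  have refl: "(u, u) \<in> phase_equiv n" if "u \<in> unit_vectors n" for u
    using that equiv_phase_equiv by (meson equiv_def refl_onD)
  have card_classes: "card ((\<lambda>i. ?c (h i)) ` {..<n}) = n"
    if h: "\<And>i. i < n \<Longrightarrow> h i \<in> unit_vectors n"
      and orth: "\<And>i j. i < n \<Longrightarrow> j < n \<Longrightarrow> h i \<bullet>c h j = (if i = j then 1 else 0)" for h
  proof -
    have "inj_on (\<lambda>i. ?c (h i)) {..<n}"
    proof (rule inj_onI, rule ccontr)
      fix i j assume "i \<in> {..<n}" "j \<in> {..<n}" and c: "?c (h i) = ?c (h j)" and ne: "i \<noteq> j"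
      then have ij: "i < n" "j < n" by simp_all
      have "(h i, h j) \<in> phase_equiv n" using eq_class[OF h[OF ij(1)] h[OF ij(2)]] c by simp
      \<comment> \<open>Orthogonality depends only on classes, so \<open>h i\<close> orthogonal to
        \<open>h j\<close> in the same class would make \<open>h j\<close> orthogonal to
        itself.\<close>
      from orthogonal_cong_phase[OF this refl[OF h[OF ij(2)]]] show False
        using orth[OF ij] orth[OF ij(2) ij(2)] ne by simp
    qed
    then show ?thesis by (simp add: card_image)
  qed
  have cF: "card F = n" and cG: "card G = n"
    using card_classes[OF f(1) orth_f] card_classes[OF g(1) orth_g] by (simp_all add: F_def G_def)
  have fin: "finite F" "finite G" by (simp_all add: F_def G_def)
  show "F = G"
  proof (rule ccontr)
    assume ne: "F \<noteq> G"
    \<comment> \<open>Both sets have n elements, so either inclusion would already be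
      equality.\<close>
    then have "\<not> G \<subseteq> F" "\<not> F \<subseteq> G"
      using card_subset_eq[of F G] card_subset_eq[of G F] cF cG fin by auto
    then obtain x y where x: "x \<in> G" "x \<notin> F" and y: "y \<in> F" "y \<notin> G"
      by blast
    obtain k where k: "k < n" "x = ?c (g k)" using x by (auto simp: G_def)
    obtain m where m: "m < n" "y = ?c (f m)" using y by (auto simp: F_def)
    have "card (F \<union> G) + card (F \<inter> G) = n + n"
      using card_Un_Int[OF fin] cF cG by simp
    then have "card (F - {y}) \<le> card (F \<inter> G)"
      using card y(1) fin cF by (simp add: card_Diff_singleton)
    \<comment> \<open>Inclusion-exclusion gives at least n - 1 common classes, and y is not one of
      them; so y is the only class of F missing from G.\<close>
    then have int: "F \<inter> G = F - {y}"
      using y fin by (intro card_seteq) auto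
    have "g k \<bullet>c f j = 0" if j: "j < n" "j \<noteq> m" for j
    proof -
      have "inj_on (\<lambda>i. ?c (f i)) {..<n}"
        using cF by (intro eq_card_imp_inj_on) (simp_all add: F_def)
      then have "?c (f j) \<noteq> y"
        using j m inj_on_eq_iff[of "\<lambda>i. ?c (f i)" "{..<n}" j m] by simp
      then have "?c (f j) \<in> G"
        using int j by (auto simp: F_def)
      then obtain l where l: "l < n" "?c (f j) = ?c (g l)"
        by (auto simp: G_def)
      \<comment> \<open>The class of \<open>g k\<close> is x, which lies outside F, whereas the
        class of \<open>g l\<close> is that of \<open>f j\<close>.\<close>
      have "l \<noteq> k"
        using l k x(2) j by (auto simp: F_def)
      moreover have "(f j, g l) \<in> phase_equiv n"
        using l(2) eq_class[OF f(1)[OF j(1)] g(1)[OF l(1)]] by simp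
      ultimately show ?thesis
        using orthogonal_cong_phase[OF refl[OF g(1)[OF k(1)]]] orth_g[OF k(1) l(1)] by simp
    qed
    then have "g k = (g k \<bullet>c f m) \<cdot>\<^sub>v f m"
      using f(1) g(1)[OF k(1)] m(1) orth_f
      by (intro orthonormal_all_but_one[of n]) (auto simp: unit_vectors_def)
    then have "(g k, f m) \<in> phase_equiv n"
      using f(1) g(1) k m by (intro phase_equivI)
    then have "x = y"
      using eq_class[OF g(1)[OF k(1)] f(1)[OF m(1)]] k(2) m(2) by simp
    then show False
      using x y by simp
  qed
qed

lemma qls_cardinality_neq_Suc:
  assumes "quantum_latin_square n \<phi>"
  shows "qls_cardinality n \<phi> \<noteq> Suc n"
proof
  assume Suc: "qls_cardinality n \<phi> = Suc n"
  define R where "R i = (\<lambda>j. phase_equiv n `` {\<phi> i j}) ` {..<n}" for i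
  have Q: "{\<phi> i j | i j. i < n \<and> j < n} // phase_equiv n = (\<Union>i<n. R i)"
    unfolding quotient_def R_def by fastforce
  have card_Q: "card (\<Union>i<n. R i) = Suc n"
    using Suc unfolding qls_cardinality_def Q .
  have unit: "\<phi> i j \<in> unit_vectors n" if "i < n" "j < n" for i j
    using assms that by (auto simp: quantum_latin_square_def)
  have basis: "orthonormal_basis n (\<phi> i)" if "i < n" for i
    using assms that by (auto simp: quantum_latin_square_def)
  have eq: "R i = R 0" if i: "i < n" for i
  proof -
    have "0 < n" using i by simp
    have "R i \<union> R 0 \<subseteq> (\<Union>i<n. R i)"
      using i \<open>0 < n\<close> by blast
    then have "card (R i \<union> R 0) \<le> Suc n"
      unfolding card_Q[symmetric] by (intro card_mono) (simp_all add: R_def)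
    then show ?thesis
      unfolding R_def
      by (intro orthonormal_classes_eq unit basis i \<open>0 < n\<close>)
  qed
  have "finite (R 0)" by (simp add: R_def)
  moreover have "(\<Union>i<n. R i) \<subseteq> R 0" using eq by blast
  ultimately have "card (\<Union>i<n. R i) \<le> card (R 0)" by (rule card_mono)
  also have "\<dots> \<le> n"
    unfolding R_def using card_image_le[of "{..<n}"] by simp
  finally show False
    using card_Q by simp
qed

section \<open>Quantum Latin squares from tables of Gaussian integers\<close>

definition cnormalize :: "complex vec \<Rightarrow> complex vec" where
  "cnormalize v = complex_of_real (1 / sqrt (Re (v \<bullet>c v))) \<cdot>\<^sub>v v"

text \<open>The order on complex numbers compares real parts and demands equal imaginary parts, so
  positivity of \<open>v \<bullet>c v\<close> yields both claims.\<close>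

lemma cscalar_self_pos:
  fixes v :: "complex vec"
  assumes "v \<in> carrier_vec n" "v \<noteq> 0\<^sub>v n"
  shows "0 < Re (v \<bullet>c v)" "v \<bullet>c v = complex_of_real (Re (v \<bullet>c v))"
proof -
  have "0 < v \<bullet>c v"
    using assms by simp
  then show "0 < Re (v \<bullet>c v)" "v \<bullet>c v = complex_of_real (Re (v \<bullet>c v))"
    by (simp_all add: less_complex_def complex_eq_iff)
qed

lemma cnormalize_in_unit_vectors:
  assumes "v \<in> carrier_vec n" "v \<noteq> 0\<^sub>v n"
  shows "cnormalize v \<in> unit_vectors n"
proof -
  note pos = cscalar_self_pos[OF assms]
  have "cnormalize v \<bullet>c cnormalize v
      = complex_of_real (1 / sqrt (Re (v \<bullet>c v))) * complex_of_real (1 / sqrt (Re (v \<bullet>c v))) * (v \<bullet>c v)"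
    using assms by (simp add: cnormalize_def conjugate_smult_vec)
  also have "\<dots> = complex_of_real (1 / sqrt (Re (v \<bullet>c v)) * (1 / sqrt (Re (v \<bullet>c v))) * Re (v \<bullet>c v))"
    by (simp only: of_real_mult flip: pos(2))
  also have "\<dots> = 1"
  proof -
    have "1 / sqrt (Re (v \<bullet>c v)) * (1 / sqrt (Re (v \<bullet>c v))) * Re (v \<bullet>c v) = 1"
      using pos(1) by simp
    then show ?thesis by (simp only: of_real_1)
  qed
  finally show ?thesis
    using assms by (simp add: unit_vectors_def cnormalize_def)
qed

lemma cnormalize_orthogonal:
  assumes "u \<in> carrier_vec n" "v \<in> carrier_vec n" "u \<bullet>c v = 0"
  shows "cnormalize u \<bullet>c cnormalize v = 0"
  using assms by (simp add: cnormalize_def conjugate_smult_vec)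

text \<open>Orthogonality is assumed only for i < j, the pairs that \<open>sorted_wrt\<close>
  inspects; the reversed pairs follow by conjugate symmetry.\<close>

lemma orthonormal_basis_cnormalize:
  assumes f: "\<And>i. i < n \<Longrightarrow> f i \<in> carrier_vec n" "\<And>i. i < n \<Longrightarrow> f i \<noteq> 0\<^sub>v n"
    and orth: "\<And>i j. i < j \<Longrightarrow> j < n \<Longrightarrow> f i \<bullet>c f j = 0"
  shows "orthonormal_basis n (\<lambda>i. cnormalize (f i))"
proof -
  have unit: "cnormalize (f i) \<in> unit_vectors n" if "i < n" for i
    using cnormalize_in_unit_vectors f that by blast
  have "cnormalize (f i) \<bullet>c cnormalize (f j) = (if i = j then 1 else 0)"
    if ij: "i < n" "j < n" for i j
  proof (cases i j rule: linorder_cases)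
    case less
    then show ?thesis
      using cnormalize_orthogonal[OF f(1)[OF ij(1)] f(1)[OF ij(2)] orth[OF less ij(2)]] by simp
  next
    case equal
    then show ?thesis
      using unit[OF ij(1)] by (simp add: unit_vectors_def)
  next
    case greater
    have "f i \<bullet>c f j = 0"
      by (rule cscalar_commute_zero[OF f(1)[OF ij(2)] f(1)[OF ij(1)] orth[OF greater ij(1)]])
    then show ?thesis
      using cnormalize_orthogonal[OF f(1)[OF ij(1)] f(1)[OF ij(2)]] greater by simp
  qed
  moreover have "cnormalize (f i) \<in> carrier_vec n" if "i < n" for i
    using unit[OF that] by (simp add: unit_vectors_def)
  ultimately show ?thesis
    unfolding orthonormal_basis_def by (intro conjI allI impI orthonormal_imp_basis) auto
qed

section \<open>Executable arithmetic on Gaussian integer vectors\<close>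

type_synonym gauss = "int \<times> int"

definition gauss_complex :: "gauss \<Rightarrow> complex" where
  "gauss_complex z = Complex (of_int (fst z)) (of_int (snd z))"

definition gauss_vec :: "gauss list \<Rightarrow> complex vec" where
  "gauss_vec xs = vec_of_list (map gauss_complex xs)"

text \<open>The head term is (a + bi)(c - di): the second argument is conjugated, as in
  \<open>\<bullet>c\<close>. The sum stops at the end of the shorter list, so it is the inner
  product only for lists of equal length.\<close>

fun gauss_inner :: "gauss list \<Rightarrow> gauss list \<Rightarrow> gauss" where
  "gauss_inner ((a, b) # xs) ((c, d) # ys) =
     (case gauss_inner xs ys of (p, q) \<Rightarrow> (a * c + b * d + p, b * c - a * d + q))"
| "gauss_inner _ _ = (0, 0)"

lemma gauss_complex_eq_iff [simp]: "gauss_complex y = gauss_complex z \<longleftrightarrow> y = z"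
  by (auto simp: gauss_complex_def prod_eq_iff)

lemma gauss_complex_eq_0_iff [simp]: "gauss_complex z = 0 \<longleftrightarrow> z = (0, 0)"
  by (auto simp: gauss_complex_def prod_eq_iff complex_eq_iff)

lemma gauss_vec_carrier: "gauss_vec xs \<in> carrier_vec (length xs)"
  unfolding gauss_vec_def by (rule carrier_vecI) simp

lemma gauss_vec_inner:
  "length xs = length ys \<Longrightarrow> gauss_vec xs \<bullet>c gauss_vec ys = gauss_complex (gauss_inner xs ys)"
proof (induction xs ys rule: gauss_inner.induct)
  case (1 a b xs c d ys)
  then show ?case
    by (simp add: gauss_vec_def gauss_complex_def complex_eq_iff split: prod.split)
qed (auto simp: gauss_vec_def gauss_complex_def complex_eq_iff)

text \<open>Scaling by a nonzero t preserves zeros, so the first nonzero entries stand at the same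
  position. There the equation reads z = t * z, which forces t = 1.\<close>

lemma find_eq_Some_smult_imp_eq:
  assumes "find (\<lambda>z. z \<noteq> (0, 0)) xs = Some z" "find (\<lambda>z. z \<noteq> (0, 0)) ys = Some z"
    and "t \<noteq> 0" and "map gauss_complex xs = map (\<lambda>y. t * gauss_complex y) ys"
  shows "xs = ys"
  using assms
proof (induction xs arbitrary: ys)
  case (Cons x xs)
  then obtain y ys' where ys: "ys = y # ys'" and xy: "gauss_complex x = t * gauss_complex y"
    and rest: "map gauss_complex xs = map (\<lambda>y. t * gauss_complex y) ys'"
    by (cases ys) auto
  show ?case
  proof (cases "x = (0, 0)")
    case True
    then have "gauss_complex y = 0"
      using xy \<open>t \<noteq> 0\<close> by (metis gauss_complex_eq_0_iff mult_eq_0_iff)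
    then have y: "y = (0, 0)" by simp
    have "xs = ys'"
    proof (rule Cons.IH)
      show "find (\<lambda>z. z \<noteq> (0, 0)) xs = Some z" "find (\<lambda>z. z \<noteq> (0, 0)) ys' = Some z"
        using Cons.prems(1,2) True y ys by simp_all
    qed fact+
    then show ?thesis
      using ys True y by simp
  next
    case False
    then have "y \<noteq> (0, 0)"
      using xy by (metis gauss_complex_eq_0_iff mult_zero_right)
    then have "x = z" "y = z"
      using False Cons.prems(1,2) ys by simp_all
    then have "t = 1"
      using xy False by simp
    have "map gauss_complex xs = map gauss_complex ys'"
      using rest \<open>t = 1\<close> by simp
    moreover have "inj gauss_complex" by (rule injI) simp
    ultimately show ?thesis
      using ys \<open>x = z\<close> \<open>y = z\<close> by (simp add: inj_map_eq_map)
  qed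
qed simp

text \<open>Since all vectors have the same first nonzero entry \<open>N\<close>, distinct ones span
  distinct lines; this is what allows counting phase classes by \<open>remdups\<close>.\<close>

definition gauss_qls :: "nat \<Rightarrow> int \<Rightarrow> gauss list list list \<Rightarrow> bool" where
  "gauss_qls n N T \<longleftrightarrow>
     length T = n \<and> N \<noteq> 0 \<and>
     (\<forall>r \<in> set T. length r = n \<and>
        (\<forall>v \<in> set r. length v = n \<and> find (\<lambda>z. z \<noteq> (0, 0)) v = Some (N, 0))) \<and>
     (\<forall>r \<in> set (T @ map (\<lambda>j. map (\<lambda>r. r ! j) T) [0..<n]).
        sorted_wrt (\<lambda>u v. gauss_inner u v = (0, 0)) r)"

text \<open>Both assumptions are closed and executable for a concrete table, so
  \<open>code_simp\<close> can decide them; everything about complex numbers is settled here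
  once.\<close>

lemma gauss_qls_witness:
  assumes T: "gauss_qls n N T" and c: "length (remdups (concat T)) = c"
  shows "\<exists>\<phi>. quantum_latin_square n \<phi> \<and> qls_cardinality n \<phi> = c"
proof -
  define \<phi> where "\<phi> = (\<lambda>i j. cnormalize (gauss_vec (T ! i ! j)))"
  have len: "length T = n" "N \<noteq> 0"
    using T by (simp_all add: gauss_qls_def)
  have row: "length r = n" if "r \<in> set T" for r
    using T that by (simp add: gauss_qls_def)
  have entry: "length v = n" "find (\<lambda>z. z \<noteq> (0, 0)) v = Some (N, 0)"
    if "r \<in> set T" "v \<in> set r" for r v
    using T that by (simp_all add: gauss_qls_def)
  have mem: "T ! i \<in> set T" "T ! i ! j \<in> set (T ! i)" if "i < n" "j < n" for i j
    using that len row by simp_all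
  have len_entry: "length (T ! i ! j) = n" if "i < n" "j < n" for i j
    using entry(1) mem that by blast
  have carrier: "gauss_vec v \<in> carrier_vec n" if "r \<in> set T" "v \<in> set r" for r v
    using gauss_vec_carrier[of v] entry[OF that] by simp
  have nonzero: "gauss_vec v \<noteq> 0\<^sub>v n" if rv: "r \<in> set T" "v \<in> set r" for r v
  proof
    assume zero: "gauss_vec v = 0\<^sub>v n"
    have "z = (0, 0)" if z: "z \<in> set v" for z
    proof -
      obtain k where "k < length v" "z = v ! k"
        using z by (metis in_set_conv_nth)
      then have "gauss_complex z = gauss_vec v $ k"
        by (simp add: gauss_vec_def index_vec_of_list)
      then show ?thesis
        using \<open>k < length v\<close> zero entry(1)[OF rv] by simp
    qed
    then have "find (\<lambda>z. z \<noteq> (0, 0)) v = None"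
      by (auto simp: find_None_iff)
    then show False
      using entry(2)[OF rv] by simp
  qed
  have unit: "cnormalize (gauss_vec v) \<in> unit_vectors n" if "r \<in> set T" "v \<in> set r" for r v
    using cnormalize_in_unit_vectors carrier nonzero that by blast
  have orth: "gauss_vec u \<bullet>c gauss_vec v = 0"
    if "length u = n" "length v = n" "gauss_inner u v = (0, 0)" for u v
    using gauss_vec_inner[of u v] that by simp
  have orth_row: "gauss_vec (T ! i ! j) \<bullet>c gauss_vec (T ! i ! k) = 0" if "i < n" "j < k" "k < n" for i j k
  proof (rule orth)
    have "sorted_wrt (\<lambda>u v. gauss_inner u v = (0, 0)) (T ! i)"
      using T mem(1) that by (auto simp: gauss_qls_def)
    then show "gauss_inner (T ! i ! j) (T ! i ! k) = (0, 0)"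
      using that row[OF mem(1)] by (simp add: sorted_wrt_iff_nth_less)
  qed (use that len_entry in simp_all)
  have orth_col: "gauss_vec (T ! j ! i) \<bullet>c gauss_vec (T ! k ! i) = 0" if "i < n" "j < k" "k < n" for i j k
  proof (rule orth)
    have "sorted_wrt (\<lambda>u v. gauss_inner u v = (0, 0)) (map (\<lambda>r. r ! i) T)"
      using T that(1) unfolding gauss_qls_def set_append set_map by fastforce
    then show "gauss_inner (T ! j ! i) (T ! k ! i) = (0, 0)"
      using that len by (simp add: sorted_wrt_iff_nth_less)
  qed (use that len_entry in simp_all)
  have "quantum_latin_square n \<phi>"
    unfolding quantum_latin_square_def \<phi>_def
  proof (intro conjI allI impI)
    fix i j assume "i < n" "j < n"
    then show "cnormalize (gauss_vec (T ! i ! j)) \<in> unit_vectors n"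
      using unit mem by blast
  next
    fix i assume i: "i < n"
    show "orthonormal_basis n (\<lambda>j. cnormalize (gauss_vec (T ! i ! j)))"
      using carrier[OF mem(1)[OF i] mem(2)[OF i]] nonzero[OF mem(1)[OF i] mem(2)[OF i]] orth_row[OF i]
      by (intro orthonormal_basis_cnormalize)
  next
    fix j assume j: "j < n"
    show "orthonormal_basis n (\<lambda>i. cnormalize (gauss_vec (T ! i ! j)))"
      using carrier[OF mem(1)[OF _ j] mem(2)[OF _ j]] nonzero[OF mem(1)[OF _ j] mem(2)[OF _ j]] orth_col[OF j]
      by (intro orthonormal_basis_cnormalize)
  qed
  moreover have "qls_cardinality n \<phi> = c"
  proof -
    let ?k = "\<lambda>v. phase_equiv n `` {cnormalize (gauss_vec v)}"
    have set_T: "set (concat T) = {T ! i ! j | i j. i < n \<and> j < n}"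
    proof (intro equalityI subsetI)
      fix v assume "v \<in> set (concat T)"
      then obtain r where "r \<in> set T" "v \<in> set r" by auto
      then obtain i j where "i < n" "r = T ! i" "j < n" "v = r ! j"
        using len(1) row by (metis in_set_conv_nth)
      then show "v \<in> {T ! i ! j | i j. i < n \<and> j < n}" by blast
    next
      fix v assume "v \<in> {T ! i ! j | i j. i < n \<and> j < n}"
      then show "v \<in> set (concat T)"
        using mem by fastforce
    qed
    have "{\<phi> i j | i j. i < n \<and> j < n} // phase_equiv n = ?k ` set (concat T)"
      unfolding set_T quotient_def \<phi>_def by blast
    \<comment> \<open>Distinct lists must give distinct classes, so that removing duplicate lists
      counts classes.\<close>
    moreover have "inj_on ?k (set (concat T))"
    proof (rule inj_onI)
      fix u v assume "u \<in> set (concat T)" "v \<in> set (concat T)" and eq: "?k u = ?k v"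
      then obtain r s where r: "r \<in> set T" "u \<in> set r" and s: "s \<in> set T" "v \<in> set s"
        by auto
      have "(cnormalize (gauss_vec u), cnormalize (gauss_vec v)) \<in> phase_equiv n"
        using eq eq_equiv_class_iff[OF equiv_phase_equiv unit[OF r] unit[OF s]] by simp
      then obtain t where "t \<noteq> 0" "cnormalize (gauss_vec u) = t \<cdot>\<^sub>v cnormalize (gauss_vec v)"
        by (rule phase_equivE)
      \<comment> \<open>These are the two normalization factors; undoing them exhibits u as
        \<open>t * b / a\<close> times v entrywise. The common leading entry then makes this scalar
        1.\<close>
      moreover define a b where "a = complex_of_real (1 / sqrt (Re (gauss_vec u \<bullet>c gauss_vec u)))"
        and "b = complex_of_real (1 / sqrt (Re (gauss_vec v \<bullet>c gauss_vec v)))"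
      moreover have ab: "a \<noteq> 0" "b \<noteq> 0"
        using cscalar_self_pos(1)[OF carrier[OF r] nonzero[OF r]]
          cscalar_self_pos(1)[OF carrier[OF s] nonzero[OF s]] by (auto simp: a_def b_def)
      ultimately have uv: "a \<cdot>\<^sub>v gauss_vec u = (t * b) \<cdot>\<^sub>v gauss_vec v"
        by (simp add: cnormalize_def smult_smult_assoc)
      have "gauss_complex (u ! k) = (t * b / a) * gauss_complex (v ! k)" if "k < n" for k
      proof -
        have "a * gauss_vec u $ k = t * b * gauss_vec v $ k"
          using arg_cong[OF uv, of "\<lambda>w. w $ k"] that carrier[OF r] carrier[OF s] by simp
        then show ?thesis
          using ab that entry(1)[OF r] entry(1)[OF s]
          by (simp add: gauss_vec_def index_vec_of_list field_simps)
      qed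
      then have "map gauss_complex u = map (\<lambda>y. (t * b / a) * gauss_complex y) v"
        using entry(1)[OF r] entry(1)[OF s] by (intro nth_equalityI) simp_all
      then show "u = v"
        using find_eq_Some_smult_imp_eq[OF entry(2)[OF r] entry(2)[OF s], of "t * b / a"] ab \<open>t \<noteq> 0\<close>
        by simp
    qed
    ultimately show ?thesis
      unfolding qls_cardinality_def c[symmetric] by (simp add: card_image length_remdups_card_conv)
  qed
  ultimately show ?thesis by blast
qed

definition integer_table :: "int list list list \<Rightarrow> gauss list list list" where
  "integer_table = map (map (map (\<lambda>x. (x, 0))))"

definition gauss_mult :: "gauss \<Rightarrow> gauss \<Rightarrow> gauss" where
  "gauss_mult y z = (fst y * fst z - snd y * snd z, fst y * snd z + snd y * fst z)"

text \<open>Two products sharing a factor with entries of constant modulus have, up to scale, the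
  inner product of their other factors: rows of the table inherit orthogonality from
  \<open>H\<close>, columns from \<open>F\<close>. Taking \<open>H = F\<close> of order 6 would
  leave at most 21 distinct products, by commutativity, which is why the matrices used below
  differ.\<close>

definition schur_products :: "gauss list list \<Rightarrow> gauss list list \<Rightarrow> gauss list list list" where
  "schur_products F H = map (\<lambda>f. map (map2 gauss_mult f) H) F"

section \<open>Tables of order 6\<close>

text \<open>The integer tables come from a computer search: starting from a Latin square on the standard
  basis, two or three rows or columns at a time were refilled at random with short integer vectors.\<close>

lemma qls6_cardinality_6:
  "\<exists>\<phi>. quantum_latin_square 6 \<phi> \<and> qls_cardinality 6 \<phi> = 6"
  by (rule gauss_qls_witness[where N = 1 and T = "integer_table
   [[[0,0,0,1,0,0], [0,0,0,0,0,1], [0,0,0,0,1,0], [0,0,1,0,0,0], [0,1,0,0,0,0], [1,0,0,0,0,0]],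
    [[0,1,0,0,0,0], [1,0,0,0,0,0], [0,0,0,0,0,1], [0,0,0,0,1,0], [0,0,1,0,0,0], [0,0,0,1,0,0]],
    [[0,0,0,0,0,1], [0,1,0,0,0,0], [0,0,1,0,0,0], [0,0,0,1,0,0], [1,0,0,0,0,0], [0,0,0,0,1,0]],
    [[0,0,1,0,0,0], [0,0,0,0,1,0], [1,0,0,0,0,0], [0,0,0,0,0,1], [0,0,0,1,0,0], [0,1,0,0,0,0]],
    [[0,0,0,0,1,0], [0,0,0,1,0,0], [0,1,0,0,0,0], [1,0,0,0,0,0], [0,0,0,0,0,1], [0,0,1,0,0,0]],
    [[1,0,0,0,0,0], [0,0,1,0,0,0], [0,0,0,1,0,0], [0,1,0,0,0,0], [0,0,0,0,1,0], [0,0,0,0,0,1]]]"]) code_simp+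

text \<open>The first and last rows meet the second and third columns in a 2 by 2 subsquare on two
  basis vectors, rotated to their sum and difference. Both basis vectors still occur elsewhere, so
  the count is 6 + 2.\<close>

lemma qls6_cardinality_8:
  "\<exists>\<phi>. quantum_latin_square 6 \<phi> \<and> qls_cardinality 6 \<phi> = 8"
  by (rule gauss_qls_witness[where N = 1 and T = "integer_table
   [[[0,0,0,0,1,0], [0,1,1,0,0,0], [0,1,-1,0,0,0], [0,0,0,1,0,0], [0,0,0,0,0,1], [1,0,0,0,0,0]],
    [[0,0,0,1,0,0], [0,0,0,0,1,0], [0,0,0,0,0,1], [0,1,0,0,0,0], [1,0,0,0,0,0], [0,0,1,0,0,0]],
    [[1,0,0,0,0,0], [0,0,0,0,0,1], [0,0,0,1,0,0], [0,0,1,0,0,0], [0,0,0,0,1,0], [0,1,0,0,0,0]],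
    [[0,1,0,0,0,0], [1,0,0,0,0,0], [0,0,0,0,1,0], [0,0,0,0,0,1], [0,0,1,0,0,0], [0,0,0,1,0,0]],
    [[0,0,1,0,0,0], [0,0,0,1,0,0], [1,0,0,0,0,0], [0,0,0,0,1,0], [0,1,0,0,0,0], [0,0,0,0,0,1]],
    [[0,0,0,0,0,1], [0,1,-1,0,0,0], [0,1,1,0,0,0], [1,0,0,0,0,0], [0,0,0,1,0,0], [0,0,0,0,1,0]]]"]) code_simp+

text \<open>The first basis vector occurs only mixed with the fifth or with the sixth, giving four
  new lines, and never by itself: 5 + 4.\<close>

lemma qls6_cardinality_9:
  "\<exists>\<phi>. quantum_latin_square 6 \<phi> \<and> qls_cardinality 6 \<phi> = 9"
  by (rule gauss_qls_witness[where N = 1 and T = "integer_table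
   [[[0,0,1,0,0,0], [0,0,0,0,1,0], [0,1,0,0,0,0], [0,0,0,1,0,0], [1,0,0,0,0,1], [1,0,0,0,0,-1]],
    [[0,1,0,0,0,0], [1,0,0,0,0,-1], [0,0,0,1,0,0], [0,0,1,0,0,0], [0,0,0,0,1,0], [1,0,0,0,0,1]],
    [[0,0,0,0,0,1], [0,0,1,0,0,0], [1,0,0,0,-1,0], [1,0,0,0,1,0], [0,1,0,0,0,0], [0,0,0,1,0,0]],
    [[1,0,0,0,1,0], [0,0,0,1,0,0], [0,0,0,0,0,1], [1,0,0,0,-1,0], [0,0,1,0,0,0], [0,1,0,0,0,0]],
    [[1,0,0,0,-1,0], [0,1,0,0,0,0], [1,0,0,0,1,0], [0,0,0,0,0,1], [0,0,0,1,0,0], [0,0,1,0,0,0]],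
    [[0,0,0,1,0,0], [1,0,0,0,0,1], [0,0,1,0,0,0], [0,1,0,0,0,0], [1,0,0,0,0,-1], [0,0,0,0,1,0]]]"]) code_simp+

lemma qls6_cardinality_10:
  "\<exists>\<phi>. quantum_latin_square 6 \<phi> \<and> qls_cardinality 6 \<phi> = 10"
  by (rule gauss_qls_witness[where N = 1 and T = "integer_table
   [[[0,0,0,1,0,0], [0,0,0,0,0,1], [0,0,1,0,0,0], [0,1,0,0,0,0], [0,0,0,0,1,0], [1,0,0,0,0,0]],
    [[0,1,-1,0,0,0], [1,0,0,0,0,0], [0,0,0,0,0,1], [0,0,0,0,1,0], [0,0,0,1,0,0], [0,1,1,0,0,0]],
    [[0,1,1,0,0,0], [0,0,0,0,1,0], [0,0,0,1,0,0], [0,0,0,0,0,1], [1,0,0,0,0,0], [0,1,-1,0,0,0]],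
    [[1,0,0,0,1,0], [0,0,1,0,0,0], [1,0,0,0,-1,0], [0,0,0,1,0,0], [0,1,0,0,0,0], [0,0,0,0,0,1]],
    [[1,0,0,0,-1,0], [0,1,0,0,0,0], [1,0,0,0,1,0], [0,0,1,0,0,0], [0,0,0,0,0,1], [0,0,0,1,0,0]],
    [[0,0,0,0,0,1], [0,0,0,1,0,0], [0,1,0,0,0,0], [1,0,0,0,0,0], [0,0,1,0,0,0], [0,0,0,0,1,0]]]"]) code_simp+

lemma qls6_cardinality_11:
  "\<exists>\<phi>. quantum_latin_square 6 \<phi> \<and> qls_cardinality 6 \<phi> = 11"
  by (rule gauss_qls_witness[where N = 1 and T = "integer_table
   [[[0,1,0,0,0,-1], [1,0,0,0,0,0], [0,0,0,0,1,0], [0,0,1,0,0,0], [0,1,0,0,0,1], [0,0,0,1,0,0]],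
    [[0,0,1,0,0,0], [0,1,0,-1,0,0], [0,1,0,1,0,0], [0,0,0,0,1,0], [1,0,0,0,0,0], [0,0,0,0,0,1]],
    [[1,0,0,0,0,0], [0,1,0,1,0,0], [0,1,0,-1,0,0], [0,0,0,0,0,1], [0,0,1,0,0,0], [0,0,0,0,1,0]],
    [[0,0,0,0,1,0], [0,0,0,0,0,1], [0,0,1,0,0,0], [1,1,0,0,0,0], [0,0,0,1,0,0], [1,-1,0,0,0,0]],
    [[0,0,0,1,0,0], [0,0,1,0,0,0], [0,0,0,0,0,1], [1,-1,0,0,0,0], [0,0,0,0,1,0], [1,1,0,0,0,0]],
    [[0,1,0,0,0,1], [0,0,0,0,1,0], [1,0,0,0,0,0], [0,0,0,1,0,0], [0,1,0,0,0,-1], [0,0,1,0,0,0]]]"]) code_simp+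

lemma qls6_cardinality_12:
  "\<exists>\<phi>. quantum_latin_square 6 \<phi> \<and> qls_cardinality 6 \<phi> = 12"
  by (rule gauss_qls_witness[where N = 1 and T = "integer_table
   [[[0,0,1,0,0,-1], [0,0,1,0,0,1], [1,0,0,0,0,0], [0,0,0,1,0,0], [0,0,0,0,1,0], [0,1,0,0,0,0]],
    [[0,0,0,1,-1,0], [0,0,0,1,1,0], [0,1,0,0,0,-1], [0,1,0,0,0,1], [1,0,0,0,0,0], [0,0,1,0,0,0]],
    [[0,1,0,0,0,0], [1,0,0,0,0,0], [0,0,1,0,0,0], [0,0,0,0,1,0], [0,0,0,0,0,1], [0,0,0,1,0,0]],
    [[0,0,1,0,0,1], [0,0,1,0,0,-1], [0,0,0,1,0,0], [1,0,0,0,0,0], [0,1,0,0,0,0], [0,0,0,0,1,0]],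
    [[0,0,0,1,1,0], [0,0,0,1,-1,0], [0,1,0,0,0,1], [0,1,0,0,0,-1], [0,0,1,0,0,0], [1,0,0,0,0,0]],
    [[1,0,0,0,0,0], [0,1,0,0,0,0], [0,0,0,0,1,0], [0,0,1,0,0,0], [0,0,0,1,0,0], [0,0,0,0,0,1]]]"]) code_simp+

lemma qls6_cardinality_13:
  "\<exists>\<phi>. quantum_latin_square 6 \<phi> \<and> qls_cardinality 6 \<phi> = 13"
  by (rule gauss_qls_witness[where N = 1 and T = "integer_table
   [[[1,0,0,0,0,0], [0,1,0,1,0,0], [0,1,0,-1,0,0], [0,0,0,0,0,1], [0,0,1,0,-1,0], [0,0,1,0,1,0]],
    [[0,1,1,0,0,0], [1,0,0,0,0,0], [0,0,0,0,1,0], [0,1,-1,0,0,0], [0,0,0,1,0,0], [0,0,0,0,0,1]],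
    [[0,0,0,1,0,0], [0,0,1,0,0,1], [0,0,1,0,0,-1], [0,0,0,0,1,0], [1,0,0,0,0,0], [0,1,0,0,0,0]],
    [[0,0,0,0,0,1], [0,1,0,-1,0,0], [0,1,0,1,0,0], [1,0,0,0,0,0], [0,0,1,0,1,0], [0,0,1,0,-1,0]],
    [[0,1,-1,0,0,0], [0,0,0,0,1,0], [1,0,0,0,0,0], [0,1,1,0,0,0], [0,0,0,0,0,1], [0,0,0,1,0,0]],
    [[0,0,0,0,1,0], [0,0,1,0,0,-1], [0,0,1,0,0,1], [0,0,0,1,0,0], [0,1,0,0,0,0], [1,0,0,0,0,0]]]"]) code_simp+

lemma qls6_cardinality_14:
  "\<exists>\<phi>. quantum_latin_square 6 \<phi> \<and> qls_cardinality 6 \<phi> = 14"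
  by (rule gauss_qls_witness[where N = 1 and T = "integer_table
   [[[0,0,0,0,1,0], [0,1,0,0,0,0], [0,0,0,1,0,0], [1,0,0,0,0,1], [0,0,1,0,0,0], [1,0,0,0,0,-1]],
    [[1,-1,0,0,0,0], [0,0,0,0,0,1], [1,1,0,0,0,0], [0,0,1,0,0,0], [0,0,0,1,0,0], [0,0,0,0,1,0]],
    [[0,0,1,0,0,1], [0,0,0,0,1,0], [0,0,1,0,0,-1], [0,1,0,-1,0,0], [1,0,0,0,0,0], [0,1,0,1,0,0]],
    [[0,0,1,0,0,-1], [1,0,0,0,0,0], [0,0,1,0,0,1], [0,1,0,1,0,0], [0,0,0,0,1,0], [0,1,0,-1,0,0]],
    [[0,0,0,1,0,0], [0,0,1,0,0,0], [0,0,0,0,1,0], [1,0,0,0,0,-1], [0,1,0,0,0,0], [1,0,0,0,0,1]],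
    [[1,1,0,0,0,0], [0,0,0,1,0,0], [1,-1,0,0,0,0], [0,0,0,0,1,0], [0,0,0,0,0,1], [0,0,1,0,0,0]]]"]) code_simp+

lemma qls6_cardinality_15:
  "\<exists>\<phi>. quantum_latin_square 6 \<phi> \<and> qls_cardinality 6 \<phi> = 15"
  by (rule gauss_qls_witness[where N = 1 and T = "integer_table
   [[[0,0,0,0,0,1], [0,1,-1,0,0,0], [1,0,0,0,-1,0], [0,0,0,1,0,0], [0,1,1,0,0,0], [1,0,0,0,1,0]],
    [[0,0,1,0,1,0], [1,0,0,0,0,0], [0,1,0,1,0,0], [0,0,1,0,-1,0], [0,0,0,0,0,1], [0,1,0,-1,0,0]],
    [[0,0,1,0,-1,0], [0,0,0,0,0,1], [0,1,0,-1,0,0], [0,0,1,0,1,0], [1,0,0,0,0,0], [0,1,0,1,0,0]],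
    [[0,1,0,0,0,0], [0,0,0,0,1,0], [0,0,1,0,0,-1], [1,0,0,0,0,0], [0,0,0,1,0,0], [0,0,1,0,0,1]],
    [[1,0,0,0,0,0], [0,0,0,1,0,0], [0,0,1,0,0,1], [0,1,0,0,0,0], [0,0,0,0,1,0], [0,0,1,0,0,-1]],
    [[0,0,0,1,0,0], [0,1,1,0,0,0], [1,0,0,0,1,0], [0,0,0,0,0,1], [0,1,-1,0,0,0], [1,0,0,0,-1,0]]]"]) code_simp+

lemma qls6_cardinality_16:
  "\<exists>\<phi>. quantum_latin_square 6 \<phi> \<and> qls_cardinality 6 \<phi> = 16"
  by (rule gauss_qls_witness[where N = 1 and T = "integer_table
   [[[0,1,0,0,0,-1], [0,0,1,0,0,0], [0,1,0,0,0,1], [0,0,0,1,1,0], [1,0,0,0,0,0], [0,0,0,1,-1,0]],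
    [[0,0,1,0,0,0], [0,0,0,0,0,1], [0,0,0,0,1,0], [1,-1,0,0,0,0], [0,0,0,1,0,0], [1,1,0,0,0,0]],
    [[1,0,0,1,0,0], [0,1,0,0,0,0], [1,0,0,-1,0,0], [0,0,1,0,0,-1], [0,0,0,0,1,0], [0,0,1,0,0,1]],
    [[1,0,0,-1,0,0], [0,0,0,0,1,0], [1,0,0,1,0,0], [0,0,1,0,0,1], [0,1,0,0,0,0], [0,0,1,0,0,-1]],
    [[0,0,0,0,1,0], [0,0,0,1,0,0], [0,0,1,0,0,0], [1,1,0,0,0,0], [0,0,0,0,0,1], [1,-1,0,0,0,0]],
    [[0,1,0,0,0,1], [1,0,0,0,0,0], [0,1,0,0,0,-1], [0,0,0,1,-1,0], [0,0,1,0,0,0], [0,0,0,1,1,0]]]"]) code_simp+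

lemma qls6_cardinality_17:
  "\<exists>\<phi>. quantum_latin_square 6 \<phi> \<and> qls_cardinality 6 \<phi> = 17"
  by (rule gauss_qls_witness[where N = 1 and T = "integer_table
   [[[1,0,0,1,0,0], [0,0,0,0,1,0], [0,1,0,0,0,0], [0,0,1,0,0,0], [0,0,0,0,0,1], [1,0,0,-1,0,0]],
    [[0,1,0,0,0,1], [0,0,1,1,0,0], [1,0,0,0,0,0], [0,0,0,0,1,0], [0,0,1,-1,0,0], [0,1,0,0,0,-1]],
    [[0,1,0,0,0,-1], [0,0,1,-1,0,0], [0,0,0,0,1,0], [1,0,0,0,0,0], [0,0,1,1,0,0], [0,1,0,0,0,1]],
    [[1,0,0,-1,0,0], [0,0,0,0,0,1], [0,0,1,0,0,0], [0,1,0,0,0,0], [0,0,0,0,1,0], [1,0,0,1,0,0]],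
    [[0,0,1,0,-1,0], [1,-1,0,0,0,0], [0,0,0,1,0,1], [0,0,0,1,0,-1], [1,1,0,0,0,0], [0,0,1,0,1,0]],
    [[0,0,1,0,1,0], [1,1,0,0,0,0], [0,0,0,1,0,-1], [0,0,0,1,0,1], [1,-1,0,0,0,0], [0,0,1,0,-1,0]]]"]) code_simp+

lemma qls6_cardinality_18:
  "\<exists>\<phi>. quantum_latin_square 6 \<phi> \<and> qls_cardinality 6 \<phi> = 18"
  by (rule gauss_qls_witness[where N = 1 and T = "integer_table
   [[[0,0,1,0,0,0], [1,0,0,0,1,0], [0,1,0,0,0,0], [1,0,0,0,-1,0], [0,0,0,1,0,0], [0,0,0,0,0,1]],
    [[0,0,0,0,0,1], [1,1,-1,0,-1,0], [0,0,0,1,0,0], [1,1,1,0,1,0], [1,-1,0,0,0,0], [0,0,1,0,-1,0]],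
    [[1,0,0,0,0,0], [0,0,0,1,0,0], [0,0,1,0,0,0], [0,0,0,0,0,1], [0,0,0,0,1,0], [0,1,0,0,0,0]],
    [[0,0,0,0,1,0], [0,1,1,0,0,0], [1,0,0,0,0,0], [0,1,-1,0,0,0], [0,0,0,0,0,1], [0,0,0,1,0,0]],
    [[0,0,0,1,0,0], [1,-1,1,0,-1,0], [0,0,0,0,0,1], [1,-1,-1,0,1,0], [1,1,0,0,0,0], [0,0,1,0,1,0]],
    [[0,1,0,0,0,0], [0,0,0,0,0,1], [0,0,0,0,1,0], [0,0,0,1,0,0], [0,0,1,0,0,0], [1,0,0,0,0,0]]]"]) code_simp+

lemma qls6_cardinality_19:
  "\<exists>\<phi>. quantum_latin_square 6 \<phi> \<and> qls_cardinality 6 \<phi> = 19"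
  by (rule gauss_qls_witness[where N = 1 and T = "integer_table
   [[[0,0,1,-1,0,0], [1,1,0,0,0,0], [1,-1,0,0,0,0], [0,0,0,0,0,1], [0,0,1,1,0,0], [0,0,0,0,1,0]],
    [[0,0,1,1,-1,-1], [0,0,1,1,1,1], [0,0,0,0,1,-1], [0,1,0,0,0,0], [0,0,1,-1,0,0], [1,0,0,0,0,0]],
    [[0,0,1,1,1,1], [0,0,1,-1,1,-1], [1,1,0,0,0,0], [0,0,1,0,-1,0], [1,-1,0,0,0,0], [0,0,0,1,0,-1]],
    [[1,0,0,0,0,0], [0,0,1,0,-1,0], [0,0,0,1,0,0], [0,0,1,0,1,0], [0,0,0,0,0,1], [0,1,0,0,0,0]],
    [[0,0,0,0,1,-1], [1,-1,0,0,0,0], [0,0,0,0,1,1], [0,0,0,1,0,0], [1,1,0,0,0,0], [0,0,1,0,0,0]],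
    [[0,1,0,0,0,0], [0,0,0,1,0,-1], [0,0,1,0,0,0], [1,0,0,0,0,0], [0,0,0,0,1,0], [0,0,0,1,0,1]]]"]) code_simp+

lemma qls6_cardinality_20:
  "\<exists>\<phi>. quantum_latin_square 6 \<phi> \<and> qls_cardinality 6 \<phi> = 20"
  by (rule gauss_qls_witness[where N = 1 and T = "integer_table
   [[[0,0,0,0,1,0], [0,0,0,1,0,0], [0,0,1,0,0,0], [0,0,0,0,0,1], [1,-1,0,0,0,0], [1,1,0,0,0,0]],
    [[1,0,0,0,0,0], [0,1,0,0,0,0], [0,0,0,0,0,1], [0,0,1,0,0,0], [0,0,0,1,1,0], [0,0,0,1,-1,0]],
    [[0,1,0,0,0,0], [1,0,0,0,0,0], [0,0,0,1,0,0], [0,0,0,0,1,0], [0,0,1,0,0,1], [0,0,1,0,0,-1]],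
    [[0,0,1,0,0,0], [0,0,0,0,0,1], [0,0,0,0,1,0], [0,0,0,1,0,0], [1,1,0,0,0,0], [1,-1,0,0,0,0]],
    [[0,0,0,1,0,-1], [0,0,1,0,-1,0], [1,0,0,0,0,0], [0,1,0,0,0,0], [0,0,1,-1,1,-1], [0,0,1,1,1,1]],
    [[0,0,0,1,0,1], [0,0,1,0,1,0], [0,1,0,0,0,0], [1,0,0,0,0,0], [0,0,1,1,-1,-1], [0,0,1,-1,-1,1]]]"]) code_simp+

lemma qls6_cardinality_21:
  "\<exists>\<phi>. quantum_latin_square 6 \<phi> \<and> qls_cardinality 6 \<phi> = 21"
  by (rule gauss_qls_witness[where N = 1 and T = "integer_table
   [[[0,0,0,1,0,0], [0,0,0,0,1,0], [1,0,0,0,0,-1], [0,1,0,0,0,0], [0,0,1,0,0,0], [1,0,0,0,0,1]],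
    [[0,0,0,0,1,0], [1,-1,-1,0,0,1], [0,0,0,1,0,0], [1,0,1,0,0,0], [0,1,0,0,0,1], [1,1,-1,0,0,-1]],
    [[1,1,1,0,0,1], [0,0,0,1,0,0], [0,0,0,0,1,0], [1,0,-1,0,0,0], [0,1,0,0,0,-1], [1,-1,1,0,0,-1]],
    [[1,-1,0,0,0,0], [1,1,0,0,0,0], [0,0,1,0,0,0], [0,0,0,0,0,1], [0,0,0,1,0,0], [0,0,0,0,1,0]],
    [[0,0,1,0,0,-1], [0,0,1,0,0,1], [0,1,0,0,0,0], [0,0,0,0,1,0], [1,0,0,0,0,0], [0,0,0,1,0,0]],
    [[1,1,-1,0,0,-1], [1,-1,1,0,0,-1], [1,0,0,0,0,1], [0,0,0,1,0,0], [0,0,0,0,1,0], [0,1,1,0,0,0]]]"]) code_simp+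

lemma qls6_cardinality_22:
  "\<exists>\<phi>. quantum_latin_square 6 \<phi> \<and> qls_cardinality 6 \<phi> = 22"
  \<comment> \<open>Orthogonal pairs such as (1,2) and (2,-1) have no integral representatives that
    both start with 1; starting with 2 they become (2,4) and (2,-1).\<close>
  by (rule gauss_qls_witness[where N = 2 and T = "integer_table
   [[[0,0,2,4,0,0], [2,2,0,0,0,0], [0,0,2,-1,0,0], [0,0,0,0,2,0], [2,-2,0,0,0,0], [0,0,0,0,0,2]],
    [[0,0,0,0,2,0], [0,0,2,2,0,0], [0,0,0,0,0,2], [0,2,0,0,0,0], [0,0,2,-2,0,0], [2,0,0,0,0,0]],
    [[0,0,2,-1,0,0], [0,0,0,0,2,-2], [0,0,2,4,0,0], [2,0,0,0,0,0], [0,0,0,0,2,2], [0,2,0,0,0,0]],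
    [[2,0,0,0,0,0], [0,0,2,-2,-2,-2], [0,2,0,0,0,0], [0,0,0,2,0,-2], [0,0,2,2,-2,2], [0,0,2,0,2,0]],
    [[0,2,0,0,0,0], [0,0,2,-2,2,2], [2,0,0,0,0,0], [0,0,0,2,0,2], [0,0,2,2,2,-2], [0,0,2,0,-2,0]],
    [[0,0,0,0,0,2], [2,-2,0,0,0,0], [0,0,0,0,2,0], [0,0,2,0,0,0], [2,2,0,0,0,0], [0,0,0,2,0,0]]]"]) code_simp+

lemma qls6_cardinality_23:
  "\<exists>\<phi>. quantum_latin_square 6 \<phi> \<and> qls_cardinality 6 \<phi> = 23"
  by (rule gauss_qls_witness[where N = 1 and T = "integer_table
   [[[1,0,0,0,0,0], [0,0,1,1,-1,-1], [0,0,1,1,1,1], [0,0,0,0,1,-1], [0,0,1,-1,0,0], [0,1,0,0,0,0]],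
    [[0,0,0,0,1,0], [1,1,0,0,0,0], [1,-1,0,0,0,0], [0,0,1,-1,0,0], [0,0,1,1,0,0], [0,0,0,0,0,1]],
    [[0,0,1,0,0,-1], [0,0,1,-1,-1,1], [1,1,0,0,0,0], [0,0,1,1,1,1], [1,-1,0,0,0,0], [0,0,0,1,-1,0]],
    [[0,0,0,1,0,0], [0,0,1,0,1,0], [0,0,1,0,-1,0], [0,1,0,0,0,0], [0,0,0,0,0,1], [1,0,0,0,0,0]],
    [[0,0,1,0,0,1], [1,-1,0,0,0,0], [0,0,1,-1,1,-1], [0,0,1,1,-1,-1], [1,1,0,0,0,0], [0,0,0,1,1,0]],
    [[0,1,0,0,0,0], [0,0,0,1,0,1], [0,0,0,1,0,-1], [1,0,0,0,0,0], [0,0,0,0,1,0], [0,0,1,0,0,0]]]"]) code_simp+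

lemma qls6_cardinality_24:
  "\<exists>\<phi>. quantum_latin_square 6 \<phi> \<and> qls_cardinality 6 \<phi> = 24"
  by (rule gauss_qls_witness[where N = 1 and T = "integer_table
   [[[0,0,1,-1,1,1], [1,1,0,1,0,1], [0,0,1,1,1,-1], [1,1,0,-1,0,-1], [0,0,1,0,-1,0], [1,-1,0,0,0,0]],
    [[0,0,1,1,-1,1], [1,-1,0,1,0,-1], [0,0,1,-1,-1,-1], [1,-1,0,-1,0,1], [0,0,1,0,1,0], [1,1,0,0,0,0]],
    [[0,1,0,0,0,0], [1,0,0,-1,0,0], [0,0,1,0,0,1], [0,0,0,0,1,0], [1,0,0,1,0,0], [0,0,1,0,0,-1]],
    [[0,0,0,1,1,0], [0,0,1,0,0,0], [1,0,0,0,0,0], [0,1,0,0,0,1], [0,1,0,0,0,-1], [0,0,0,1,-1,0]],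
    [[1,0,0,0,0,0], [0,1,0,0,0,-1], [0,0,0,1,-1,0], [0,0,1,0,0,0], [0,1,0,0,0,1], [0,0,0,1,1,0]],
    [[0,0,1,0,0,-1], [0,0,0,0,1,0], [0,1,0,0,0,0], [1,0,0,1,0,0], [1,0,0,-1,0,0], [0,0,1,0,0,1]]]"]) code_simp+

lemma qls6_cardinality_25:
  "\<exists>\<phi>. quantum_latin_square 6 \<phi> \<and> qls_cardinality 6 \<phi> = 25"
  by (rule gauss_qls_witness[where N = 2 and T = "integer_table
   [[[0,0,2,0,2,2], [0,0,2,0,-1,-1], [0,0,0,2,0,0], [0,2,0,0,0,0], [2,0,0,0,0,0], [0,0,0,0,2,-2]],
    [[0,2,0,2,0,0], [0,2,0,-2,0,0], [2,0,0,0,0,0], [0,0,0,0,2,0], [0,0,0,0,0,2], [0,0,2,0,0,0]],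
    [[0,2,0,-2,0,0], [2,0,-2,0,-4,0], [0,0,2,0,-1,1], [2,0,2,0,0,-4], [0,2,0,2,0,0], [2,0,0,0,1,1]],
    [[2,0,0,0,-2,2], [2,0,0,0,1,-1], [0,0,0,0,2,2], [0,0,0,2,0,0], [0,0,2,0,0,0], [0,2,0,0,0,0]],
    [[2,0,-2,0,2,0], [0,2,0,2,0,0], [0,0,2,0,2,-2], [2,0,2,0,0,2], [0,2,0,-2,0,0], [2,0,0,0,-2,-2]],
    [[2,0,2,0,0,-2], [2,0,2,0,0,4], [0,2,0,0,0,0], [2,0,-2,0,0,0], [0,0,0,0,2,0], [0,0,0,2,0,0]]]"]) code_simp+

lemma qls6_cardinality_26:
  "\<exists>\<phi>. quantum_latin_square 6 \<phi> \<and> qls_cardinality 6 \<phi> = 26"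
  by (rule gauss_qls_witness[where N = 1 and T = "integer_table
   [[[0,1,0,0,0,-1], [0,0,1,0,0,0], [1,1,0,1,0,1], [1,0,0,-1,0,0], [0,0,0,0,1,0], [1,-1,0,1,0,-1]],
    [[0,0,1,0,0,0], [0,0,0,0,0,1], [1,-1,0,0,0,0], [0,0,0,0,1,0], [0,0,0,1,0,0], [1,1,0,0,0,0]],
    [[0,1,0,0,0,1], [0,0,0,0,1,0], [1,1,0,-1,0,-1], [1,0,0,1,0,0], [0,0,1,0,0,0], [1,-1,0,-1,0,1]],
    [[0,0,0,1,-1,0], [0,1,0,0,0,0], [0,0,1,-1,-1,1], [0,0,1,0,0,-1], [1,0,0,0,0,0], [0,0,1,1,1,1]],
    [[1,0,0,0,0,0], [0,0,0,1,0,0], [0,0,1,0,1,0], [0,1,0,0,0,0], [0,0,0,0,0,1], [0,0,1,0,-1,0]],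
    [[0,0,0,1,1,0], [1,0,0,0,0,0], [0,0,1,1,-1,-1], [0,0,1,0,0,1], [0,1,0,0,0,0], [0,0,1,-1,1,-1]]]"]) code_simp+

lemma qls6_cardinality_27:
  "\<exists>\<phi>. quantum_latin_square 6 \<phi> \<and> qls_cardinality 6 \<phi> = 27"
  by (rule gauss_qls_witness[where N = 2 and T = "integer_table
   [[[2,1,-2,1,2,2], [0,2,0,-2,0,0], [2,4,4,4,2,-4], [2,0,0,0,-2,0], [2,-2,1,-2,2,-1], [0,0,2,0,0,2]],
    [[2,4,-2,4,-4,-4], [2,0,2,0,0,0], [2,1,-2,-2,2,-1], [0,2,0,0,0,2], [2,-2,-2,1,-1,2], [0,0,0,2,2,0]],
    [[0,2,0,-2,0,0], [0,2,0,2,0,0], [2,0,0,0,-2,0], [2,0,0,0,2,0], [0,0,2,0,0,2], [0,0,2,0,0,-2]],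
    [[2,0,2,0,0,0], [2,0,-2,0,0,0], [0,2,0,0,0,2], [0,2,0,0,0,-2], [0,0,0,2,2,0], [0,0,0,2,-2,0]],
    [[0,0,0,0,2,-2], [0,0,0,0,2,2], [0,0,2,-2,0,0], [0,0,2,2,0,0], [2,2,0,0,0,0], [2,-2,0,0,0,0]],
    [[2,-2,-2,-2,-1,-1], [0,0,0,0,2,-2], [2,-2,1,1,2,2], [0,0,2,-2,0,0], [2,-2,4,4,-4,-4], [2,2,0,0,0,0]]]"]) code_simp+

lemma qls6_cardinality_28:
  "\<exists>\<phi>. quantum_latin_square 6 \<phi> \<and> qls_cardinality 6 \<phi> = 28"
  by (rule gauss_qls_witness[where N = 1 and T = "integer_table
   [[[0,0,0,0,0,1], [0,0,0,1,0,0], [0,0,1,0,-1,0], [1,1,0,0,0,0], [1,-1,-1,0,-1,0], [1,-1,1,0,1,0]],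
    [[1,1,-1,0,-1,0], [1,-1,-1,0,1,0], [0,0,0,1,0,1], [0,0,0,1,0,-1], [1,0,1,0,0,0], [0,1,0,0,1,0]],
    [[1,0,0,0,1,0], [1,0,0,0,-1,0], [0,1,0,0,0,0], [0,0,1,0,0,0], [0,0,0,0,0,1], [0,0,0,1,0,0]],
    [[0,0,0,1,0,0], [0,0,0,0,0,1], [0,0,1,0,1,0], [1,-1,0,0,0,0], [1,1,-1,0,1,0], [1,1,1,0,-1,0]],
    [[0,1,1,0,0,0], [0,1,-1,0,0,0], [1,0,0,0,0,0], [0,0,0,0,1,0], [0,0,0,1,0,0], [0,0,0,0,0,1]],
    [[1,-1,1,0,-1,0], [1,1,1,0,1,0], [0,0,0,1,0,-1], [0,0,0,1,0,1], [0,1,0,0,-1,0], [1,0,-1,0,0,0]]]"]) code_simp+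

lemma qls6_cardinality_30:
  "\<exists>\<phi>. quantum_latin_square 6 \<phi> \<and> qls_cardinality 6 \<phi> = 30"
  by (rule gauss_qls_witness[where N = 1 and T = "integer_table
   [[[0,1,0,0,0,0], [1,0,0,-1,0,0], [0,0,0,0,1,0], [1,0,1,1,0,-1], [0,0,1,0,0,1], [1,0,-1,1,0,1]],
    [[0,0,1,0,0,0], [0,0,0,0,1,-1], [0,0,0,1,0,0], [1,-1,0,0,1,1], [1,1,0,0,0,0], [1,-1,0,0,-1,-1]],
    [[0,0,0,1,0,0], [0,0,0,0,1,1], [0,0,1,0,0,0], [1,1,0,0,-1,1], [1,-1,0,0,0,0], [1,1,0,0,1,-1]],
    [[0,0,0,0,0,1], [0,1,-1,0,0,0], [1,0,0,0,0,0], [0,1,1,-1,1,0], [0,0,0,1,1,0], [0,1,1,1,-1,0]],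
    [[0,0,0,0,1,0], [1,0,0,1,0,0], [0,1,0,0,0,0], [1,0,-1,-1,0,-1], [0,0,1,0,0,-1], [1,0,1,-1,0,1]],
    [[1,0,0,0,0,0], [0,1,1,0,0,0], [0,0,0,0,0,1], [0,1,-1,1,1,0], [0,0,0,1,-1,0], [0,1,-1,-1,-1,0]]]"]) code_simp+

text \<open>Each row and each column is, up to reordering, a conference matrix of order 6: five
  entries of modulus 1 per vector, with the zero in a different place each time. The vector
  (1,0,1,1,1,-1) occurs once in every row and column and the other 30 entries are distinct.\<close>

lemma qls6_cardinality_31:
  "\<exists>\<phi>. quantum_latin_square 6 \<phi> \<and> qls_cardinality 6 \<phi> = 31"
  by (rule gauss_qls_witness[where N = 1 and T = "integer_table
   [[[1,1,-1,0,1,1], [1,0,1,1,1,-1], [1,1,0,-1,-1,-1], [1,-1,1,-1,0,1], [1,-1,-1,1,-1,0], [0,1,1,1,-1,1]],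
    [[1,0,1,1,1,-1], [1,-1,-1,0,1,1], [0,1,1,-1,1,1], [1,1,0,1,-1,1], [1,1,-1,-1,0,-1], [1,-1,1,-1,-1,0]],
    [[1,-1,0,1,-1,1], [1,1,1,-1,0,1], [1,-1,-1,-1,1,0], [1,0,1,1,1,-1], [0,1,-1,1,1,1], [1,1,-1,0,-1,-1]],
    [[0,1,-1,1,-1,-1], [1,-1,0,-1,-1,-1], [1,0,1,1,1,-1], [1,1,-1,-1,1,0], [1,1,1,0,-1,1], [1,-1,-1,1,0,1]],
    [[1,-1,-1,-1,0,-1], [1,1,-1,1,-1,0], [1,-1,1,0,-1,1], [0,1,1,-1,-1,-1], [1,0,1,1,1,-1], [1,1,0,-1,1,1]],
    [[1,1,1,-1,-1,0], [0,1,-1,-1,1,-1], [1,1,-1,1,0,1], [1,-1,-1,0,-1,-1], [1,-1,0,-1,1,1], [1,0,1,1,1,-1]]]"]) code_simp+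

lemma qls6_cardinality_32:
  "\<exists>\<phi>. quantum_latin_square 6 \<phi> \<and> qls_cardinality 6 \<phi> = 32"
  by (rule gauss_qls_witness[where N = 1 and T = "integer_table
   [[[1,0,0,0,1,0], [0,0,0,1,0,0], [0,0,0,0,0,1], [1,-1,-1,0,-1,0], [0,1,-1,0,0,0], [1,1,1,0,-1,0]],
    [[1,0,1,0,-1,1], [1,0,-1,0,1,1], [0,1,-1,1,-1,0], [1,1,0,-1,0,-1], [0,1,1,1,1,0], [1,-1,0,1,0,-1]],
    [[0,1,0,0,0,0], [0,0,1,0,0,1], [0,0,0,1,1,0], [0,0,1,1,-1,-1], [1,0,0,0,0,0], [0,0,1,-1,1,-1]],
    [[0,0,0,1,0,0], [1,0,0,0,-1,0], [0,1,1,0,0,0], [1,-1,1,0,1,0], [0,0,0,0,0,1], [1,1,-1,0,1,0]],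
    [[0,0,1,0,0,-1], [0,1,0,0,0,0], [1,0,0,0,0,0], [0,0,1,-1,-1,1], [0,0,0,1,-1,0], [0,0,1,1,1,1]],
    [[1,0,-1,0,-1,-1], [1,0,1,0,1,-1], [0,1,-1,-1,1,0], [1,1,0,1,0,1], [0,1,1,-1,-1,0], [1,-1,0,-1,0,1]]]"]) code_simp+

lemma qls6_cardinality_34:
  "\<exists>\<phi>. quantum_latin_square 6 \<phi> \<and> qls_cardinality 6 \<phi> = 34"
  by (rule gauss_qls_witness[where N = 2 and T = "integer_table
   [[[2,0,2,0,-2,2], [2,-2,0,2,2,0], [2,1,-1,-1,0,-1], [0,2,-1,2,0,1], [0,2,4,2,0,-4], [0,2,2,-2,4,2]],
    [[0,2,0,0,0,0], [0,0,0,0,0,2], [0,0,2,-2,0,0], [0,0,0,0,2,0], [2,0,0,0,0,0], [0,0,2,2,0,0]],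
    [[2,0,0,0,0,-2], [0,2,0,0,2,0], [2,-2,0,0,2,2], [0,0,2,1,0,0], [0,0,2,-4,0,0], [2,2,0,0,-2,2]],
    [[2,0,-2,0,2,2], [2,2,0,2,-2,0], [0,2,2,2,4,-2], [0,2,1,-2,0,1], [0,2,-4,-2,0,-4], [2,-1,1,-1,0,-1]],
    [[0,0,2,0,2,0], [2,0,0,-2,0,0], [2,0,2,2,-2,0], [0,2,0,0,0,-4], [0,2,0,0,0,1], [2,0,-2,2,2,0]],
    [[0,0,0,2,0,0], [0,0,2,0,0,0], [0,2,0,0,0,2], [2,0,0,0,0,0], [0,0,0,0,2,0], [0,2,0,0,0,-2]]]"]) code_simp+

lemma qls6_cardinality_36:
  "\<exists>\<phi>. quantum_latin_square 6 \<phi> \<and> qls_cardinality 6 \<phi> = 36"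
  by (rule gauss_qls_witness[where N = 1 and T = "integer_table
   [[[1,0,0,-1,1,-1], [0,1,1,0,1,1], [1,0,0,-1,-1,1], [0,1,-1,0,0,0], [0,1,1,0,-1,-1], [1,0,0,1,0,0]],
    [[1,0,0,1,-1,-1], [0,1,-1,0,1,-1], [1,0,0,1,1,1], [0,1,1,0,0,0], [0,1,-1,0,-1,1], [1,0,0,-1,0,0]],
    [[0,1,1,-1,-1,0], [1,0,1,1,0,-1], [0,1,-1,1,-1,0], [1,0,0,0,0,1], [1,0,-1,-1,0,-1], [0,1,0,0,1,0]],
    [[1,1,-1,0,0,1], [1,-1,0,-1,1,0], [1,1,1,0,0,-1], [0,0,0,1,1,0], [1,-1,0,1,-1,0], [0,0,1,0,0,1]],
    [[1,-1,1,0,0,1], [1,1,0,-1,-1,0], [1,-1,-1,0,0,-1], [0,0,0,1,-1,0], [1,1,0,1,1,0], [0,0,1,0,0,-1]],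
    [[0,1,1,1,1,0], [1,0,-1,1,0,1], [0,1,-1,-1,1,0], [1,0,0,0,0,-1], [1,0,1,-1,0,1], [0,1,0,0,-1,0]]]"]) code_simp+

text \<open>For complex Hadamard matrices \<open>F\<close> and \<open>H\<close>, the entrywise products of the rows of \<open>F\<close> with
  the rows of \<open>H\<close> form a quantum Latin square up to scaling. Below, \<open>F\<close> is the matrix \<open>D\<^sub>6(c)\<close> of
  Dita's family, and \<open>H\<close> is \<open>D\<^sub>6(c)\<close> for \<open>c = 1\<close>, and the transpose of \<open>D\<^sub>6(c)\<close> for
  \<open>c = (3 + 4\<i>)/5\<close> (both matrices scaled by 5), in each case with the last two columns swapped.\<close>

lemma qls6_cardinality_33:
  "\<exists>\<phi>. quantum_latin_square 6 \<phi> \<and> qls_cardinality 6 \<phi> = 33"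
  by (rule gauss_qls_witness[where N = 1 and T = "schur_products
    [[(1,0),(1,0),(1,0),(1,0),(1,0),(1,0)],
     [(1,0),(-1,0),(0,1),(0,-1),(0,-1),(0,1)],
     [(1,0),(0,1),(-1,0),(0,1),(0,-1),(0,-1)],
     [(1,0),(0,-1),(0,1),(-1,0),(0,1),(0,-1)],
     [(1,0),(0,-1),(0,-1),(0,1),(-1,0),(0,1)],
     [(1,0),(0,1),(0,-1),(0,-1),(0,1),(-1,0)]]
    [[(1,0),(1,0),(1,0),(1,0),(1,0),(1,0)],
     [(1,0),(-1,0),(0,1),(0,-1),(0,1),(0,-1)],
     [(1,0),(0,1),(-1,0),(0,1),(0,-1),(0,-1)],
     [(1,0),(0,-1),(0,1),(-1,0),(0,-1),(0,1)],
     [(1,0),(0,-1),(0,-1),(0,1),(0,1),(-1,0)],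
     [(1,0),(0,1),(0,-1),(0,-1),(-1,0),(0,1)]]"]) code_simp+

lemma qls6_cardinality_35:
  "\<exists>\<phi>. quantum_latin_square 6 \<phi> \<and> qls_cardinality 6 \<phi> = 35"
  \<comment> \<open>Both first columns consist of 5s, so every product starts with 25. The parameter
    (3 + 4i)/5 is a rational point of the unit circle, so scaling by 5 gives Gaussian
    integers.\<close>
  by (rule gauss_qls_witness[where N = 25 and T = "schur_products
    [[(5,0),(5,0),(5,0),(5,0),(5,0),(5,0)],
     [(5,0),(-5,0),(0,5),(0,-5),(0,-5),(0,5)],
     [(5,0),(0,5),(-5,0),(-4,3),(4,-3),(0,-5)],
     [(5,0),(0,-5),(4,3),(-5,0),(0,5),(-4,-3)],
     [(5,0),(0,-5),(-4,-3),(0,5),(-5,0),(4,3)],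
     [(5,0),(0,5),(0,-5),(4,-3),(-4,3),(-5,0)]]
    [[(5,0),(5,0),(5,0),(5,0),(5,0),(5,0)],
     [(5,0),(-5,0),(0,5),(0,-5),(0,5),(0,-5)],
     [(5,0),(0,5),(-5,0),(4,3),(0,-5),(-4,-3)],
     [(5,0),(0,-5),(-4,3),(-5,0),(4,-3),(0,5)],
     [(5,0),(0,-5),(4,-3),(0,5),(-4,3),(-5,0)],
     [(5,0),(0,5),(0,-5),(-4,-3),(-5,0),(4,3)]]"]) code_simp+

theorem corollary1:
  shows "(\<forall>c::nat. c \<in> {6..36} - {7, 29} \<longrightarrow>
            (\<exists>\<phi>. quantum_latin_square 6 \<phi> \<and> qls_cardinality 6 \<phi> = c)) \<and>
         \<not> (\<exists>\<phi>. quantum_latin_square 6 \<phi> \<and> qls_cardinality 6 \<phi> = 7)"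
proof (intro conjI allI impI)
  fix c :: nat assume c: "c \<in> {6..36} - {7, 29}"
  \<comment> \<open>Turns the interval into an explicit list of 29 values, one for each square
    constructed above.\<close>
  have "\<forall>c \<in> {6..36::nat} - {7, 29}. c \<in> set
    [6, 8, 9, 10, 11, 12, 13, 14, 15, 16, 17, 18, 19, 20, 21,
     22, 23, 24, 25, 26, 27, 28, 30, 31, 32, 33, 34, 35, 36]"
    by code_simp
  then have "c \<in> set
    [6, 8, 9, 10, 11, 12, 13, 14, 15, 16, 17, 18, 19, 20, 21,
     22, 23, 24, 25, 26, 27, 28, 30, 31, 32, 33, 34, 35, 36]"
    using c by blast
  then show "\<exists>\<phi>. quantum_latin_square 6 \<phi> \<and> qls_cardinality 6 \<phi> = c"
    using
      qls6_cardinality_6 qls6_cardinality_8 qls6_cardinality_9 qls6_cardinality_10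
      qls6_cardinality_11 qls6_cardinality_12 qls6_cardinality_13 qls6_cardinality_14
      qls6_cardinality_15 qls6_cardinality_16 qls6_cardinality_17 qls6_cardinality_18
      qls6_cardinality_19 qls6_cardinality_20 qls6_cardinality_21 qls6_cardinality_22
      qls6_cardinality_23 qls6_cardinality_24 qls6_cardinality_25 qls6_cardinality_26
      qls6_cardinality_27 qls6_cardinality_28 qls6_cardinality_30 qls6_cardinality_31
      qls6_cardinality_32 qls6_cardinality_33 qls6_cardinality_34 qls6_cardinality_35
      qls6_cardinality_36
    unfolding set_simps insert_iff empty_iff by blast
next
  show "\<not> (\<exists>\<phi>. quantum_latin_square 6 \<phi> \<and> qls_cardinality 6 \<phi> = 7)"
    using qls_cardinality_neq_Suc[of 6] by auto
qed

end
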